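(* There exist an undirected graph $G=(V,E)$, edge costs $c:E\to\mathbb{R}_{\ge0}$, and two collections of pairs $\mathcal{P}_1,\mathcal{P}_2$ such that $\mathcal{P}_2$ is a different representation of $\mathcal{P}_1$, but the optimum value of Forest-BCR for the instance $(G,c,\mathcal{P}_1)$ differs from the optimum value of Forest-BCR for the instance $(G,c,\mathcal{P}_2)$.
   Context: A Steiner Forest instance $(G,c,\mathcal{P})$ consists of an undirected graph $G=(V,E)$, nonnegative edge costs $c$, and a collection $\mathcal{P}$ of pairs $\{s,t\}\subseteq V$. The demand graph of the instance is the graph on vertex set $V$ with an edge $\{s,t\}$ iff $\{s,t\}\in\mathcal{P}$. Two collections $\mathcal{P}_1,\mathcal{P}_2$ of pairs on $V$ are representations of each other if the vertex sets of the connected components of their demand graphs coincide. Let $\overrightarrow{E}$ be obtained by replacing each $\{u,v\}\in E$ by the directed edges $(u,v),(v,u)$ of cost $c(\{u,v\})$, and let $\delta^+(U)$ be the set of directed edges leaving $U\subseteq V$. Forest-BCR is the linear program with variables $x^r_e$ ($r\in V$, $e\in\overrightarrow{E}$) and $z^r_P$ ($r\in V$, $P\in\mathcal{P}$): minimize $\sum_{r\in V}\sum_{e\in\overrightarrow{E}}c(e)x^r_e$ subject to $\sum_{r\in V}z^r_P=1$ for all $P\in\mathcal{P}$; $\sum_{e\in\delta^+(U)}x^r_e\ge z^r_P$ for all $r\in V$, $P\in\mathcal{P}$ and $U\subseteq V\setminus\{r\}$ with $P\cap U\neq\emptyset$; $x\ge0$, $z\ge0$. *)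

theory Defs
  imports Complex_Main "HOL-Library.Extended_Real"
begin

text \<open>
  Edges and demand pairs are two-element subsets of the finite vertex set, so graphs are
  simple and a demand pair consists of two distinct vertices.
\<close>

definition undirected_graph :: "'a set \<Rightarrow> 'a set set \<Rightarrow> bool" where
  "undirected_graph V E \<longleftrightarrow> finite V \<and> (\<forall>e\<in>E. e \<subseteq> V \<and> card e = 2)"

definition steiner_forest_instance ::
  "'a set \<Rightarrow> 'a set set \<Rightarrow> ('a set \<Rightarrow> real) \<Rightarrow> 'a set set \<Rightarrow> bool" where
  "steiner_forest_instance V E c \<P> \<longleftrightarrow>
     undirected_graph V E \<and> (\<forall>e\<in>E. c e \<ge> 0) \<and> (\<forall>P\<in>\<P>. P \<subseteq> V \<and> card P = 2)"

definition component_sets :: "'a set \<Rightarrow> 'a set set \<Rightarrow> 'a set set" where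
  "component_sets V E = V // {(u, v). u \<in> V \<and> v \<in> V \<and> (u, v) \<in> {(s, t). {s, t} \<in> E}\<^sup>*}"

text \<open>The demand graph of a collection \<open>\<P>\<close> of pairs on \<open>V\<close> is the graph \<open>(V, \<P>)\<close>; its
  components include the singletons of vertices that lie in no pair.\<close>

definition representations :: "'a set \<Rightarrow> 'a set set \<Rightarrow> 'a set set \<Rightarrow> bool" where
  "representations V \<P>\<^sub>1 \<P>\<^sub>2 \<longleftrightarrow> component_sets V \<P>\<^sub>1 = component_sets V \<P>\<^sub>2"

definition bidirected :: "'a set set \<Rightarrow> ('a \<times> 'a) set" where
  "bidirected E = {(u, v). {u, v} \<in> E}"

definition out_edges :: "'a set set \<Rightarrow> 'a set \<Rightarrow> ('a \<times> 'a) set" where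
  "out_edges E U = {(u, v) \<in> bidirected E. u \<in> U \<and> v \<notin> U}"

definition forest_bcr_feasible ::
  "'a set \<Rightarrow> 'a set set \<Rightarrow> 'a set set
     \<Rightarrow> ('a \<Rightarrow> 'a \<times> 'a \<Rightarrow> real) \<Rightarrow> ('a \<Rightarrow> 'a set \<Rightarrow> real) \<Rightarrow> bool" where
  "forest_bcr_feasible V E \<P> x z \<longleftrightarrow>
     (\<forall>P\<in>\<P>. (\<Sum>r\<in>V. z r P) = 1) \<and>
     (\<forall>r\<in>V. \<forall>P\<in>\<P>. \<forall>U. U \<subseteq> V - {r} \<and> P \<inter> U \<noteq> {} \<longrightarrow>
        (\<Sum>e\<in>out_edges E U. x r e) \<ge> z r P) \<and>
     (\<forall>r\<in>V. \<forall>e\<in>bidirected E. x r e \<ge> 0) \<and>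
     (\<forall>r\<in>V. \<forall>P\<in>\<P>. z r P \<ge> 0)"

definition forest_bcr_cost ::
  "'a set \<Rightarrow> 'a set set \<Rightarrow> ('a set \<Rightarrow> real) \<Rightarrow> ('a \<Rightarrow> 'a \<times> 'a \<Rightarrow> real) \<Rightarrow> real" where
  "forest_bcr_cost V E c x = (\<Sum>r\<in>V. \<Sum>(u, v)\<in>bidirected E. c {u, v} * x r (u, v))"

text \<open>The optimum value is taken in the extended reals, so that it is \<open>\<infinity>\<close> for an infeasible
  program rather than an unspecified real number.\<close>

definition forest_bcr_opt ::
  "'a set \<Rightarrow> 'a set set \<Rightarrow> ('a set \<Rightarrow> real) \<Rightarrow> 'a set set \<Rightarrow> ereal" where
  "forest_bcr_opt V E c \<P> =
     Inf {ereal (forest_bcr_cost V E c x) |x z. forest_bcr_feasible V E \<P> x z}"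

end

theory Submission
  imports Defs
begin

text \<open>
  In a 4-cycle \<open>a, u, b, v\<close> with unit costs and demand \<open>{u, v}\<close>, sending half a unit from \<open>u\<close> to the
  root \<open>v\<close> along each side serves \<open>{u, v}\<close> at the cost 2 of a shortest path and, for free, gives
  \<open>{a, b}\<close> half a unit at root \<open>v\<close>. Take two such cycles through \<open>0, 1\<close>, one through \<open>1, 2\<close>, and an
  edge \<open>{1, 2}\<close>. For the demands \<open>{0, 1}, {1, 2}\<close> the three cycles leave only half of \<open>{1, 2}\<close> to pay
  for, at total cost \<open>13/2\<close>. The demand \<open>{0, 2}\<close> cannot be split over the different roots in this way:
  for every root there are seven arc-disjoint cuts, two separating the demand of each cycle from the
  root and one separating \<open>{0, 2}\<close>, so by weak duality the optimum is at least 7.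
\<close>

section \<open>Weak duality for a fixed root\<close>

lemma sum_list_cuts_eq_load:
  fixes f :: "'a \<times> 'a \<Rightarrow> real"
  assumes "finite (bidirected E)"
  shows "(\<Sum>(P, U)\<leftarrow>K. \<Sum>e\<in>out_edges E U. f e) =
    (\<Sum>(u, v)\<in>bidirected E. real (length (filter (\<lambda>(P, U). u \<in> U \<and> v \<notin> U) K)) * f (u, v))"
proof (induction K)
  case Nil
  then show ?case by simp
next
  case (Cons k K)
  obtain P U where k: "k = (P, U)" by (cases k)
  have "out_edges E U = {e \<in> bidirected E. fst e \<in> U \<and> snd e \<notin> U}"
    by (auto simp: out_edges_def)
  then have "(\<Sum>e\<in>out_edges E U. f e) =
      (\<Sum>e\<in>bidirected E. if fst e \<in> U \<and> snd e \<notin> U then f e else 0)"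
    using assms by (simp add: sum.inter_filter)
  with Cons.IH show ?case
    by (auto simp: k sum.distrib[symmetric] split_def algebra_simps intro!: sum.cong)
qed

text \<open>The list \<open>K\<close> acts as an integral dual solution for root \<open>r\<close>,
  each entry having multiplier 1, and \<open>load\<close> is its dual feasibility. Adding the cut
  constraints in \<open>K\<close> and exchanging the sums gives each arc its load as coefficient,
  which \<open>c\<close> dominates because \<open>x\<close> is nonnegative.\<close>

lemma cut_packing_le_root_cost:
  assumes feas: "forest_bcr_feasible V E \<P> x z"
    and fin: "finite (bidirected E)"
    and r: "r \<in> V"
    and cuts: "\<And>P U. (P, U) \<in> set K \<Longrightarrow> P \<in> \<P> \<and> U \<subseteq> V - {r} \<and> P \<inter> U \<noteq> {}"
    and load: "\<And>u v. (u, v) \<in> bidirected E \<Longrightarrow>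
      real (length (filter (\<lambda>(P, U). u \<in> U \<and> v \<notin> U) K)) \<le> c {u, v}"
  shows "(\<Sum>(P, U)\<leftarrow>K. z r P) \<le> (\<Sum>(u, v)\<in>bidirected E. c {u, v} * x r (u, v))"
proof -
  have "(\<Sum>(P, U)\<leftarrow>K. z r P) \<le> (\<Sum>(P, U)\<leftarrow>K. \<Sum>e\<in>out_edges E U. x r e)"
    using feas r cuts unfolding forest_bcr_feasible_def
    by (intro sum_list_mono) (auto split: prod.splits)
  also have "\<dots> =
      (\<Sum>(u, v)\<in>bidirected E. real (length (filter (\<lambda>(P, U). u \<in> U \<and> v \<notin> U) K)) * x r (u, v))"
    by (rule sum_list_cuts_eq_load[OF fin])
  also have "\<dots> \<le> (\<Sum>(u, v)\<in>bidirected E. c {u, v} * x r (u, v))"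
    using feas r load unfolding forest_bcr_feasible_def
    by (intro sum_mono) (auto intro!: mult_right_mono)
  finally show ?thesis .
qed

text \<open>Each demand of one collection is realised by a path in the other, so both reachability
  relations agree, and with them their classes.\<close>

lemma representationsI:
  assumes "\<And>s t. {s, t} \<in> \<P>\<^sub>1 \<Longrightarrow> (s, t) \<in> {(s, t). {s, t} \<in> \<P>\<^sub>2}\<^sup>*"
    and "\<And>s t. {s, t} \<in> \<P>\<^sub>2 \<Longrightarrow> (s, t) \<in> {(s, t). {s, t} \<in> \<P>\<^sub>1}\<^sup>*"
  shows "representations V \<P>\<^sub>1 \<P>\<^sub>2"
proof -
  have "{(s, t). {s, t} \<in> \<P>\<^sub>1}\<^sup>* = {(s, t). {s, t} \<in> \<P>\<^sub>2}\<^sup>*"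
    using assms by (intro equalityI rtrancl_subset_rtrancl) auto
  then show ?thesis
    by (simp add: representations_def component_sets_def)
qed

section \<open>The instance\<close>

definition cycle_edges :: "nat set set" where
  "cycle_edges = {{0, 3}, {0, 4}, {1, 3}, {1, 4}, {0, 5}, {0, 6}, {1, 5}, {1, 6},
     {1, 7}, {1, 8}, {2, 7}, {2, 8}, {1, 2}}"

text \<open>Opposite corners of the cycles \<open>0,3,1,4\<close>, \<open>0,5,1,6\<close> and
  \<open>1,7,2,8\<close>.\<close>

definition cycle_demands :: "nat set set" where
  "cycle_demands = {{3, 4}, {5, 6}, {7, 8}}"

definition path_demands :: "nat set set" where
  "path_demands = {{0, 1}, {1, 2}} \<union> cycle_demands"

definition star_demands :: "nat set set" where
  "star_demands = {{0, 1}, {0, 2}} \<union> cycle_demands"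

lemma bidirected_cycle_edges:
  "bidirected cycle_edges =
    {(0, 3), (0, 4), (1, 3), (1, 4), (0, 5), (0, 6), (1, 5), (1, 6),
     (1, 7), (1, 8), (2, 7), (2, 8), (1, 2),
     (3, 0), (4, 0), (3, 1), (4, 1), (5, 0), (6, 0), (5, 1), (6, 1),
     (7, 1), (8, 1), (7, 2), (8, 2), (2, 1)}"
  by (auto simp: bidirected_def cycle_edges_def doubleton_eq_iff)

lemma finite_bidirected_cycle_edges: "finite (bidirected cycle_edges)"
  by (simp add: bidirected_cycle_edges)

lemma steiner_forest_instance_cycles:
  assumes "\<P> \<subseteq> {{0, 1}, {1, 2}, {0, 2}, {3, 4}, {5, 6}, {7, 8}}"
  shows "steiner_forest_instance {..8::nat} cycle_edges (\<lambda>_. 1) \<P>"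
proof -
  have "P \<subseteq> {..8} \<and> card P = 2" if "P \<in> \<P>" for P
    using that assms by auto
  then show ?thesis
    by (simp add: steiner_forest_instance_def undirected_graph_def cycle_edges_def)
qed

section \<open>A solution of cost 13/2 for the path demands\<close>

definition flow_support :: "nat \<Rightarrow> (nat \<times> nat) set" where
  "flow_support r =
     (if r = 2 then {(1, 2)}
      else if r = 4 then {(3, 0), (0, 4), (3, 1), (1, 4)}
      else if r = 6 then {(5, 0), (0, 6), (5, 1), (1, 6)}
      else if r = 8 then {(7, 1), (1, 8), (7, 2), (2, 8)}
      else {})"

definition half_flow :: "nat \<Rightarrow> nat \<times> nat \<Rightarrow> real" where
  "half_flow r e = (if e \<in> flow_support r then 1 / 2 else 0)"

text \<open>The two cycles through \<open>0\<close> and \<open>1\<close> give \<open>{0, 1}\<close>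
  a half each, at roots 4 and 6. The third gives \<open>{1, 2}\<close> a half at root 8; the other
  half, at root 2, is paid for by the arc \<open>(1, 2)\<close>.\<close>

definition root_share :: "nat \<Rightarrow> nat set \<Rightarrow> real" where
  "root_share r P =
     (if (r, P) \<in> {(4, {3, 4}), (6, {5, 6}), (8, {7, 8})} then 1
      else if (r, P) \<in> {(4, {0, 1}), (6, {0, 1}), (8, {1, 2}), (2, {1, 2})} then 1 / 2
      else 0)"

lemma flow_support_bidirected: "flow_support r \<subseteq> bidirected cycle_edges"
  by (auto simp: flow_support_def bidirected_cycle_edges)

lemma finite_flow_support: "finite (flow_support r)"
  by (simp add: flow_support_def)

text \<open>Reduces each cut value to at most four arcs, so that an arbitrary \<open>U\<close>
  matters only through the few vertices on them.\<close>

lemma half_flow_cut: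
  "(\<Sum>e\<in>out_edges cycle_edges U. half_flow r e) =
    (\<Sum>(u, v)\<in>flow_support r. if u \<in> U \<and> v \<notin> U then 1 / 2 else 0)"
proof -
  have eq: "out_edges cycle_edges U \<inter> flow_support r =
      {e \<in> flow_support r. fst e \<in> U \<and> snd e \<notin> U}"
    using flow_support_bidirected[of r] by (auto simp: out_edges_def)
  have "finite (out_edges cycle_edges U)"
    by (rule finite_subset[OF _ finite_bidirected_cycle_edges]) (auto simp: out_edges_def)
  then have "(\<Sum>e\<in>out_edges cycle_edges U. half_flow r e) =
      (\<Sum>e\<in>out_edges cycle_edges U \<inter> flow_support r. 1 / 2)"
    by (simp only: half_flow_def sum.inter_restrict)
  also have "\<dots> = (\<Sum>(u, v)\<in>flow_support r. if u \<in> U \<and> v \<notin> U then 1 / 2 else 0)"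
    unfolding eq by (simp only: sum.inter_filter[OF finite_flow_support] split_def)
  finally show ?thesis .
qed

lemma atMost_8: "{..8::nat} = {0, 1, 2, 3, 4, 5, 6, 7, 8}"
  by auto

lemma half_flow_feasible:
  "forest_bcr_feasible {..8} cycle_edges path_demands half_flow root_share"
  unfolding forest_bcr_feasible_def
proof (intro conjI ballI allI impI)
  fix P assume "P \<in> path_demands"
  then show "(\<Sum>r\<in>{..8}. root_share r P) = 1"
    by (auto simp: path_demands_def cycle_demands_def root_share_def atMost_8 doubleton_eq_iff)
next
  fix r P U assume "P \<in> path_demands" and U: "U \<subseteq> {..8} - {r} \<and> P \<inter> U \<noteq> {}"
  have nonneg: "0 \<le> (\<Sum>e\<in>out_edges cycle_edges U. half_flow r e)"
    by (simp add: half_flow_def sum_nonneg)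
  show "root_share r P \<le> (\<Sum>e\<in>out_edges cycle_edges U. half_flow r e)"
  proof (cases "root_share r P = 0")
    case True
    with nonneg show ?thesis by simp
  next
    case False
    then have "(r, P) \<in> {(4, {3, 4}), (6, {5, 6}), (8, {7, 8})} \<union>
        {(4, {0, 1}), (6, {0, 1}), (8, {1, 2}), (2, {1, 2})}"
      by (metis UnI1 UnI2 root_share_def)
    \<comment> \<open>As the root lies outside \<open>U\<close>, each of the two paths from the
      source of a cycle flow crosses out of \<open>U\<close>, giving 1. For a share of 1/2, the arc
      from a vertex of \<open>P\<close> in \<open>U\<close> straight to the root suffices.\<close>
    with U show ?thesis
      by (elim UnE insertE emptyE)
        (auto simp: half_flow_cut root_share_def flow_support_def doubleton_eq_iff)
  qed
qed (simp_all add: half_flow_def root_share_def)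

lemma half_flow_cost: "forest_bcr_cost {..8} cycle_edges (\<lambda>_. 1) half_flow = 13 / 2"
proof -
  have "(\<Sum>(u, v)\<in>bidirected cycle_edges. 1 * half_flow r (u, v)) =
      real (card (flow_support r)) / 2" for r
  proof -
    have "(\<Sum>(u, v)\<in>bidirected cycle_edges. 1 * half_flow r (u, v)) =
        (\<Sum>e\<in>bidirected cycle_edges \<inter> flow_support r. 1 / 2)"
      unfolding sum.inter_restrict[OF finite_bidirected_cycle_edges]
      by (intro sum.cong) (auto simp: half_flow_def)
    also have "bidirected cycle_edges \<inter> flow_support r = flow_support r"
      using flow_support_bidirected by blast
    finally show ?thesis by simp
  qed
  \<comment> \<open>Three cycle flows with four arcs each and one single arc:
    \<open>(3 * 4 + 1) / 2\<close>.\<close>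
  then show ?thesis
    unfolding forest_bcr_cost_def by (simp add: atMost_8 flow_support_def)
qed

section \<open>The lower bound 7 for the star demands\<close>

definition cut_packing :: "nat \<Rightarrow> (nat set \<times> nat set) list" where
  "cut_packing r =
     [({0, 2}, if r \<in> {2, 7, 8} then {0} else {2}),
      ({3, 4}, if r = 3 then {0, 1, 4} else {3}),
      ({3, 4}, if r = 4 then {0, 1, 3} else {4}),
      ({5, 6}, if r = 5 then {0, 1, 6} else {5}),
      ({5, 6}, if r = 6 then {0, 1, 5} else {6}),
      ({7, 8}, if r = 7 then {1, 8} else if r = 8 then {1, 7} else {7}),
      ({7, 8}, if r = 7 then {2, 8} else if r = 8 then {2, 7} else {8})]"

lemma cut_packing_separates:
  assumes "r \<in> {..8}" "(P, U) \<in> set (cut_packing r)"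
  shows "P \<in> star_demands \<and> U \<subseteq> {..8} - {r} \<and> P \<inter> U \<noteq> {}"
proof -
  have "{{0, 2}, {3, 4}, {5, 6}, {7, 8}} \<subseteq> star_demands"
    unfolding star_demands_def cycle_demands_def by blast
  then have "\<forall>r\<in>{..8}. \<forall>(P, U)\<in>set (cut_packing r).
      P \<in> star_demands \<and> U \<subseteq> {..8} - {r} \<and> P \<inter> U \<noteq> {}"
    by (simp only: atMost_8 ball_simps) (simp add: cut_packing_def)
  with assms show ?thesis by blast
qed

text \<open>The cut for \<open>{0, 2}\<close> sits at the end that avoids the others:
  \<open>{0}\<close> would share arcs with \<open>{0, 1, 4}\<close> and its analogues for roots 3 to
  6, and \<open>{2}\<close> with \<open>{2, 8}\<close> or \<open>{2, 7}\<close> for roots 7 and 8.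
  Inside a cycle, the arcs leaving \<open>{0, 1, 4}\<close> start at 0 or 1, hence do not leave
  \<open>{4}\<close>.\<close>

lemma cut_packing_load:
  assumes "r \<in> {..8}" "(u, v) \<in> bidirected cycle_edges"
  shows "real (length (filter (\<lambda>(P, U). u \<in> U \<and> v \<notin> U) (cut_packing r))) \<le> 1"
proof -
  have "\<forall>r\<in>{..8}. \<forall>(u, v)\<in>bidirected cycle_edges.
      real (length (filter (\<lambda>(P, U). u \<in> U \<and> v \<notin> U) (cut_packing r))) \<le> 1"
    by (simp only: atMost_8 ball_simps) (simp add: bidirected_cycle_edges cut_packing_def)
  with assms show ?thesis by blast
qed

lemma star_demands_cost_ge:
  assumes feas: "forest_bcr_feasible {..8} cycle_edges star_demands x z"
  shows "7 \<le> forest_bcr_cost {..8} cycle_edges (\<lambda>_. 1) x"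
proof -
  have "(\<Sum>r\<le>8. z r P) = 1" if "P \<in> star_demands" for P
    using feas that by (simp add: forest_bcr_feasible_def)
  moreover have "{{0, 2}, {3, 4}, {5, 6}, {7, 8}} \<subseteq> star_demands"
    unfolding star_demands_def cycle_demands_def by blast
  \<comment> \<open>For every root the packing lists \<open>{0, 2}\<close> once and each cycle
    demand twice. Shares add up to 1 over the roots, so the total is
    \<open>1 + 2 + 2 + 2\<close>.\<close>
  ultimately have "7 = (\<Sum>r\<le>8. \<Sum>(P, U)\<leftarrow>cut_packing r. z r P)"
    by (simp add: cut_packing_def sum.distrib flip: sum_distrib_left)
  also have "\<dots> \<le> forest_bcr_cost {..8} cycle_edges (\<lambda>_. 1) x"
    unfolding forest_bcr_cost_def
    by (intro sum_mono cut_packing_le_root_cost[OF feas finite_bidirected_cycle_edges]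
        cut_packing_separates cut_packing_load)
  finally show ?thesis .
qed

lemma representations_path_star: "representations {..8} path_demands star_demands"
proof (rule representationsI)
  let ?R = "{(s, t). {s, t} \<in> path_demands}" and ?S = "{(s, t). {s, t} \<in> star_demands}"
  have "(0, 1) \<in> ?S" "(1, 0) \<in> ?S" "(0, 2) \<in> ?S" "(2, 0) \<in> ?S"
    by (auto simp: star_demands_def doubleton_eq_iff)
  \<comment> \<open>The detour runs through 0 here, and through 1 for \<open>?R\<close>
    below.\<close>
  then have S: "(1, 2) \<in> ?S\<^sup>*" "(2, 1) \<in> ?S\<^sup>*"
    by (blast intro: rtrancl_trans r_into_rtrancl)+
  have "(0, 1) \<in> ?R" "(1, 0) \<in> ?R" "(1, 2) \<in> ?R" "(2, 1) \<in> ?R"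
    by (auto simp: path_demands_def doubleton_eq_iff)
  then have R: "(0, 2) \<in> ?R\<^sup>*" "(2, 0) \<in> ?R\<^sup>*"
    by (blast intro: rtrancl_trans r_into_rtrancl)+
  fix s t
  show "(s, t) \<in> ?S\<^sup>*" if "{s, t} \<in> path_demands"
  proof (cases "{s, t} \<in> star_demands")
    case False
    with that have "{s, t} = {1, 2}" by (auto simp: path_demands_def star_demands_def)
    with S show ?thesis by (auto simp: doubleton_eq_iff)
  qed auto
  show "(s, t) \<in> ?R\<^sup>*" if "{s, t} \<in> star_demands"
  proof (cases "{s, t} \<in> path_demands")
    case False
    with that have "{s, t} = {0, 2}" by (auto simp: path_demands_def star_demands_def)
    with R show ?thesis by (auto simp: doubleton_eq_iff)
  qed auto
qed

theorem theorem2: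
  "\<exists>(V :: nat set) (E :: nat set set) (c :: nat set \<Rightarrow> real) (\<P>\<^sub>1 :: nat set set) (\<P>\<^sub>2 :: nat set set).
     steiner_forest_instance V E c \<P>\<^sub>1 \<and>
     steiner_forest_instance V E c \<P>\<^sub>2 \<and>
     representations V \<P>\<^sub>1 \<P>\<^sub>2 \<and> \<P>\<^sub>1 \<noteq> \<P>\<^sub>2 \<and>
     forest_bcr_opt V E c \<P>\<^sub>1 \<noteq> forest_bcr_opt V E c \<P>\<^sub>2"
proof -
  have inst: "steiner_forest_instance {..8} cycle_edges (\<lambda>_. 1) path_demands"
    "steiner_forest_instance {..8} cycle_edges (\<lambda>_. 1) star_demands"
    by (rule steiner_forest_instance_cycles,
        simp add: path_demands_def star_demands_def cycle_demands_def)+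
  have "{1, 2} \<in> path_demands" "{1, 2} \<notin> star_demands"
    by (auto simp: path_demands_def star_demands_def cycle_demands_def doubleton_eq_iff)
  then have neq: "path_demands \<noteq> star_demands" by blast
  \<comment> \<open>Bounds on the two sides of a gap are enough; neither optimum is determined
    exactly.\<close>
  have "forest_bcr_opt {..8} cycle_edges (\<lambda>_. 1) path_demands \<le> ereal (13 / 2)"
    unfolding forest_bcr_opt_def half_flow_cost[symmetric]
    using half_flow_feasible by (intro Inf_lower) blast
  also have "\<dots> < ereal 7" by simp
  also have "ereal 7 \<le> forest_bcr_opt {..8} cycle_edges (\<lambda>_. 1) star_demands"
    unfolding forest_bcr_opt_def
    by (intro Inf_greatest) (use star_demands_cost_ge in auto)
  finally have opt: "forest_bcr_opt {..8} cycle_edges (\<lambda>_. 1) path_demands \<noteq>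
      forest_bcr_opt {..8} cycle_edges (\<lambda>_. 1) star_demands"
    by simp
  show ?thesis
    by (rule exI[of _ "{..8}"], rule exI[of _ cycle_edges], rule exI[of _ "\<lambda>_. 1"],
        rule exI[of _ path_demands], rule exI[of _ star_demands])
      (intro conjI inst neq opt representations_path_star)
qed

end
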